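(* Let $w$ be an odd positive integer that is not a perfect square, and let $x,y$ be integers with $0\le x,y<\frac{w}{2}$ and $x^2+y^2\equiv -1 \pmod w$. Let $z=\frac{x+yi}{w}\in\mathbb{Q}(i)$, let $[a_0;a_1,\dots,a_m]=[0;a_1,\dots,a_m]$ be its (finite) Hurwitz continued fraction expansion, and let $(P_k)_{-1\le k\le m}$, $(Q_k)_{-1\le k\le m}$ be the associated sequences of numerators and denominators in $\mathbb{Z}[i]$. Then there is a unique integer $n$ with $0\le n<m$ such that $|Q_n|\le\sqrt{w}<|Q_{n+1}|$. If moreover $|Q_n|\ne\sqrt{w}$ for this $n$, then $$w=\bigl|(x+yi)Q_n-wP_n\bigr|^2+|Q_n|^2,$$ which gives a representation of $w$ as a sum of four integer squares, namely the squares of the real and imaginary parts of the Gaussian integers $(x+yi)Q_n-wP_n$ and $Q_n$.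
   Context: $\mathbb{Z}[i]$ denotes the ring of Gaussian integers, and $|u|=\sqrt{\Re(u)^2+\Im(u)^2}$ for $u\in\mathbb{C}$. Hurwitz continued fraction expansion: for $u\in\mathbb{C}$, let $[u]\in\mathbb{Z}[i]$ denote the Gaussian integer nearest to $u$, obtained by rounding the real part and the imaginary part of $u$ each to a nearest integer, with half-integers rounded down; thus $u-[u]$ lies in $\{s+ti : -\tfrac12\le s,t\le\tfrac12\}$. Given $z\in\mathbb{C}$, put $z_0=z$ and recursively $a_k=[z_k]$ and $z_{k+1}=(z_k-a_k)^{-1}$ as long as $z_k\neq a_k$. If $z\in\mathbb{Q}(i)$ the procedure stops at some index $m$ with $z_m=a_m$, and $[a_0;a_1,\dots,a_m]$ is called the Hurwitz continued fraction expansion of $z$. The associated sequences ($\mathcal{Q}$-pair) are defined by $P_{-1}=1,\ P_0=a_0,\ P_{k+1}=a_{k+1}P_k+P_{k-1}$ and $Q_{-1}=0,\ Q_0=1,\ Q_{k+1}=a_{k+1}Q_k+Q_{k-1}$ for $0\le k<m$, so that $P_m/Q_m=z$. *)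

theory Defs
  imports "HOL-Analysis.Analysis" "HOL-Number_Theory.Cong"
    "HOL-Computational_Algebra.Nth_Powers"
begin

definition gauss_ints :: "complex set" where
  "gauss_ints = {Complex (of_int s) (of_int t) | s t. True}"

text \<open>The integer nearest to a real \<open>r\<close>, with half-integers rounded down, is
  \<open>\<lceil>r - 1/2\<rceil>\<close>.  (The library function \<^const>\<open>round\<close> rounds half-integers up.)\<close>

definition gauss_round :: "complex \<Rightarrow> complex" where
  "gauss_round u = Complex (of_int \<lceil>Re u - 1/2\<rceil>) (of_int \<lceil>Im u - 1/2\<rceil>)"

text \<open>The complete quotients \<open>z\<^sub>k\<close> and the partial quotients \<open>a\<^sub>k = [z\<^sub>k]\<close>.  Both are
  total functions of \<open>k\<close>; beyond the index where the procedure stops the values are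
  meaningless (they come from \<open>inverse 0 = 0\<close>).\<close>

primrec hurwitz_rem :: "complex \<Rightarrow> nat \<Rightarrow> complex" where
  "hurwitz_rem z 0 = z"
| "hurwitz_rem z (Suc k) = inverse (hurwitz_rem z k - gauss_round (hurwitz_rem z k))"

definition hurwitz_digit :: "complex \<Rightarrow> nat \<Rightarrow> complex" where
  "hurwitz_digit z k = gauss_round (hurwitz_rem z k)"

definition hurwitz_stops :: "complex \<Rightarrow> nat \<Rightarrow> bool" where
  "hurwitz_stops z k \<longleftrightarrow> hurwitz_rem z k = hurwitz_digit z k"

text \<open>The index of the last partial quotient.  It is well defined for every \<open>z\<close> in
  \<open>\<rat>(\<i>)\<close>, by lemma \<open>hurwitz_terminates\<close> below.\<close>

definition hurwitz_last :: "complex \<Rightarrow> nat" where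
  "hurwitz_last z = (LEAST k. hurwitz_stops z k)"

text \<open>The sequences \<open>P\<^sub>k\<close> and \<open>Q\<^sub>k\<close> for \<open>k \<ge> 0\<close>.  The initial values \<open>P\<^sub>-\<^sub>1 = 1\<close> and
  \<open>Q\<^sub>-\<^sub>1 = 0\<close> enter through the equations for \<open>k = 1\<close>.\<close>

fun cf_num :: "(nat \<Rightarrow> 'a::comm_ring_1) \<Rightarrow> nat \<Rightarrow> 'a" where
  "cf_num a 0 = a 0"
| "cf_num a (Suc 0) = a 1 * a 0 + 1"
| "cf_num a (Suc (Suc k)) = a (Suc (Suc k)) * cf_num a (Suc k) + cf_num a k"

fun cf_den :: "(nat \<Rightarrow> 'a::comm_ring_1) \<Rightarrow> nat \<Rightarrow> 'a" where
  "cf_den a 0 = 1"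
| "cf_den a (Suc 0) = a 1 * 1 + 0"
| "cf_den a (Suc (Suc k)) = a (Suc (Suc k)) * cf_den a (Suc k) + cf_den a k"

lemma gauss_round_in: "gauss_round u \<in> gauss_ints"
  by (auto simp: gauss_round_def gauss_ints_def)

lemma gauss_ints_diff_mult:
  assumes "p \<in> gauss_ints" "q \<in> gauss_ints" "r \<in> gauss_ints"
  shows "p - q * r \<in> gauss_ints"
proof -
  obtain a b c d e f where
    "p = Complex (of_int a) (of_int b)" "q = Complex (of_int c) (of_int d)"
    "r = Complex (of_int e) (of_int f)"
    using assms by (auto simp: gauss_ints_def)
  then have "p - q * r =
      Complex (of_int (a - (c * e - d * f))) (of_int (b - (c * f + d * e)))"
    by (simp add: complex_eq_iff)
  then show ?thesis
    unfolding gauss_ints_def by blast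
qed

lemma gauss_ints_norm_square:
  assumes "p \<in> gauss_ints"
  shows "\<exists>k::nat. (cmod p)\<^sup>2 = of_nat k"
proof -
  obtain a b :: int where "p = Complex (of_int a) (of_int b)"
    using assms by (auto simp: gauss_ints_def)
  then have "(cmod p)\<^sup>2 = of_int (a\<^sup>2 + b\<^sup>2)"
    by (simp add: cmod_power2)
  also have "\<dots> = of_nat (nat (a\<^sup>2 + b\<^sup>2))"
    by simp
  finally show ?thesis by blast
qed

lemma ceiling_half_dist: "\<bar>r - of_int \<lceil>r - 1/2\<rceil>\<bar> \<le> (1/2 :: real)"
  by linarith

lemma gauss_round_dist: "(cmod (u - gauss_round u))\<^sup>2 \<le> 1/2"
proof -
  have sq: "t\<^sup>2 \<le> 1/4" if "\<bar>t\<bar> \<le> 1/2" for t :: real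
    using power_mono[OF that, of 2] by (simp add: power2_eq_square)
  show ?thesis
    using sq[OF ceiling_half_dist[of "Re u"]] sq[OF ceiling_half_dist[of "Im u"]]
    by (simp add: cmod_power2 gauss_round_def)
qed

lemma hurwitz_rem_Suc_shift:
  "hurwitz_rem z (Suc k) = hurwitz_rem (inverse (z - gauss_round z)) k"
  by (induction k) auto

lemma hurwitz_terminates:
  assumes "p \<in> gauss_ints" "q \<in> gauss_ints" "q \<noteq> 0"
  shows "\<exists>k. hurwitz_stops (p / q) k"
proof -
  obtain N :: nat where "(cmod q)\<^sup>2 = of_nat N"
    using gauss_ints_norm_square assms(2) by blast
  then show ?thesis
    using assms
  proof (induction N arbitrary: p q rule: less_induct)
    case (less N)
    define z where "z = p / q"
    define r where "r = p - q * gauss_round z"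
    have r: "r \<in> gauss_ints"
      unfolding r_def using less.prems gauss_round_in by (blast intro: gauss_ints_diff_mult)
    have rq: "r = q * (z - gauss_round z)"
      using less.prems by (simp add: r_def z_def algebra_simps)
    show ?case
    proof (cases "r = 0")
      case True
      then have "hurwitz_stops z 0"
        using rq less.prems by (simp add: hurwitz_stops_def hurwitz_digit_def)
      then show ?thesis unfolding z_def by blast
    next
      case False
      obtain M :: nat where M: "(cmod r)\<^sup>2 = of_nat M"
        using gauss_ints_norm_square r by blast
      have "(cmod r)\<^sup>2 = (cmod q)\<^sup>2 * (cmod (z - gauss_round z))\<^sup>2"
        by (simp add: rq norm_mult power_mult_distrib)
      also have "\<dots> \<le> (cmod q)\<^sup>2 * (1/2)"
        using gauss_round_dist by (intro mult_left_mono) auto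
      also have "\<dots> < (cmod q)\<^sup>2"
      proof -
        have "0 < (cmod q)\<^sup>2" using \<open>q \<noteq> 0\<close> by simp
        then show ?thesis by linarith
      qed
      finally have "M < N"
        using M less.prems by simp
      then obtain k where "hurwitz_stops (q / r) k"
        using less.IH M r False less.prems by blast
      moreover have "q / r = inverse (z - gauss_round z)"
        using less.prems by (simp add: rq divide_inverse)
      ultimately have "hurwitz_stops z (Suc k)"
        unfolding hurwitz_stops_def hurwitz_digit_def hurwitz_rem_Suc_shift by simp
      then show ?thesis unfolding z_def by blast
    qed
  qed
qed

end

theory Submission
  imports Defs
begin

text \<open>
  Put \<open>\<alpha> = x + yi\<close>, \<open>E\<^sub>n = z Q\<^sub>n - P\<^sub>n\<close> and \<open>R\<^sub>n = w E\<^sub>n = \<alpha> Q\<^sub>n - w P\<^sub>n\<close>. Since \<open>|\<alpha>|\<^sup>2 \<equiv> -1\<close>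
  modulo \<open>w\<close>, the number \<open>|R\<^sub>n|\<^sup>2 + |Q\<^sub>n|\<^sup>2\<close> is a positive multiple of \<open>w\<close>, so it suffices to exclude the
  proper multiples.

  The key invariant is that no Gaussian integer \<open>c\<close> satisfies both \<open>|z\<^sub>n\<^sub>+\<^sub>1 - c| < 1\<close> and
  \<open>|Q\<^sub>n\<^sub>-\<^sub>1 + c Q\<^sub>n| < |Q\<^sub>n|\<close>. For \<open>c = a\<^sub>n\<^sub>+\<^sub>1\<close> it shows that \<open>|Q\<^sub>n|\<close> is nondecreasing; the other
  choices of \<open>c\<close>, combined with a covering of a disc by unit discs around lattice points, give
  \<open>|E\<^sub>n| |Q\<^sub>n\<^sub>+\<^sub>1| \<le> \<surd>2\<close>. For the \<open>n\<close> in question this means \<open>|R\<^sub>n|\<^sup>2 \<le> 2w\<close>, and only \<open>w\<close> and \<open>2w\<close>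
  remain.

  If the multiple were \<open>2w\<close>, then for a suitable unit \<open>u\<close> the vector \<open>(R\<^sub>n, Q\<^sub>n)\<close> would be the sum of
  the orthogonal lattice vectors \<open>\<onehalf>(R\<^sub>n \<plusminus> u Q\<^sub>n\<^sup>*, Q\<^sub>n \<minusplus> u R\<^sub>n\<^sup>*)\<close> of squared norm \<open>w\<close>, where \<open>\<^sup>*\<close> is complex
  conjugation. Because \<open>R\<^sub>n\<^sub>+\<^sub>1 / R\<^sub>n\<close> lies in the square of side 1 centred at 0,
  \<open>(R\<^sub>n\<^sub>+\<^sub>1, Q\<^sub>n\<^sub>+\<^sub>1)\<close> would be one of them up to a unit, contradicting \<open>|Q\<^sub>n\<^sub>+\<^sub>1|\<^sup>2 > w\<close>.
\<close>

section \<open>Covering a disc by unit discs\<close>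

text \<open>
  The conclusion says that \<open>(X, Y)\<close> lies outside the open disc of centre \<open>2(a, b)\<close> and radius
  \<open>\<surd>2 |(a, b)|\<close>; so this disc is covered by the unit discs around those corners of the
  unit square that are at distance less than 1 from \<open>(a, b)\<close>.
\<close>

lemma quad_cover:
  fixes a b X Y :: real
  assumes a: "0 \<le> a" "a \<le> 1/2" and b: "0 \<le> b" "b \<le> 1/2"
    and p0: "1 \<le> X\<^sup>2 + Y\<^sup>2"
    and p1: "(a - 1)\<^sup>2 + b\<^sup>2 < 1 \<Longrightarrow> 1 \<le> (X - 1)\<^sup>2 + Y\<^sup>2"
    and p2: "a\<^sup>2 + (b - 1)\<^sup>2 < 1 \<Longrightarrow> 1 \<le> X\<^sup>2 + (Y - 1)\<^sup>2"
    and p3: "(a - 1)\<^sup>2 + (b - 1)\<^sup>2 < 1 \<Longrightarrow> 1 \<le> (X - 1)\<^sup>2 + (Y - 1)\<^sup>2"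
  shows "X\<^sup>2 + Y\<^sup>2 \<le> 2 * ((X - a)\<^sup>2 + (Y - b)\<^sup>2)"
proof -
  define N where "N = X\<^sup>2 + Y\<^sup>2"
  \<comment> \<open>\<open>F\<close> is the squared distance of (X, Y) from (2a, 2b), minus 2(a^2 +
    b^2).\<close>
  define F where "F = N - 4*a*X - 4*b*Y + 2*a\<^sup>2 + 2*b\<^sup>2"
  have goal: "?thesis \<longleftrightarrow> 0 \<le> F"
    by (simp add: F_def N_def power2_eq_square algebra_simps)
  have q0: "1 \<le> N" using p0 by (simp add: N_def)
  have q1: "a\<^sup>2 + b\<^sup>2 < 2*a \<Longrightarrow> 2*X \<le> N"
    using p1 by (simp add: N_def power2_eq_square algebra_simps)
  have q2: "a\<^sup>2 + b\<^sup>2 < 2*b \<Longrightarrow> 2*Y \<le> N"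
    using p2 by (simp add: N_def power2_eq_square algebra_simps)
  have q3: "a\<^sup>2 + b\<^sup>2 < 2*a + 2*b - 1 \<Longrightarrow> 2*X + 2*Y - 1 \<le> N"
    using p3 by (simp add: N_def power2_eq_square algebra_simps)
  \<comment> \<open>Settles the cases where the corner (0, 1) is at distance at least 1 from (c, d);
    the bound is \<open>0 \<le> F\<close> written out. For V > 1 the vertical distance alone, at
    least 1 - 2d, suffices.\<close>
  have one_sided: "0 \<le> c\<^sup>2 + d\<^sup>2 + (U\<^sup>2 + V\<^sup>2 - 4*c*U - 4*d*V + c\<^sup>2 + d\<^sup>2)"
    if c: "0 \<le> c" "c \<le> 1/2" and d: "0 \<le> d" "d \<le> 1/2"
      and dd: "2*d \<le> c\<^sup>2 + d\<^sup>2" and cU: "c\<^sup>2 + d\<^sup>2 < 2*c \<Longrightarrow> 2*U \<le> U\<^sup>2 + V\<^sup>2"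
    for c d U V :: real
  proof (cases "V \<le> 1")
    case True
    have "0 \<le> U\<^sup>2 + V\<^sup>2 - 4*c*U"
    proof (cases "c\<^sup>2 + d\<^sup>2 < 2*c")
      case 1: True
      show ?thesis
      proof (cases "U \<ge> 0")
        case True
        then have "2*c*(2*U) \<le> 1*(2*U)" using c by (intro mult_right_mono) auto
        with cU[OF 1] show ?thesis by linarith
      next
        case False
        then have "c * U \<le> 0" using c by (simp add: mult_nonneg_nonpos)
        then show ?thesis using sum_power2_ge_zero[of U V] by linarith
      qed
    next
      case False
      have "c\<^sup>2 \<le> c/2" using mult_left_mono[OF c(2) c(1)] by (simp add: power2_eq_square)
      moreover have "d\<^sup>2 \<le> d/2" using mult_left_mono[OF d(2) d(1)] by (simp add: power2_eq_square)
      ultimately have "c = 0" using False c d dd by linarith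
      then show ?thesis by simp
    qed
    moreover have "0 \<le> d * (1 - V)" using d True by simp
    ultimately show ?thesis using dd by (simp add: algebra_simps)
  next
    case False
    have "(1 - 2*d)\<^sup>2 \<le> (V - 2*d)\<^sup>2"
      using False d by (intro power_mono) auto
    moreover have "c\<^sup>2 \<le> (1/2)\<^sup>2" using c by (intro power_mono) auto
    moreover have "0 \<le> (U - 2*c)\<^sup>2" by simp
    ultimately show ?thesis using dd
      by (simp add: power2_eq_square algebra_simps)
  qed
  \<comment> \<open>Which of the corners (1, 0), (0, 1), (1, 1) are within distance 1 of (a, b): all
    of them, all but (1, 1), not (1, 0), not (0, 1).\<close>
  consider (all) "a\<^sup>2 + b\<^sup>2 < 2*a + 2*b - 1"
    | (three) "a\<^sup>2 + b\<^sup>2 \<ge> 2*a + 2*b - 1" "a\<^sup>2 + b\<^sup>2 < 2*a" "a\<^sup>2 + b\<^sup>2 < 2*b"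
    | (not1) "2*a \<le> a\<^sup>2 + b\<^sup>2" | (not2) "2*b \<le> a\<^sup>2 + b\<^sup>2"
    by linarith
  then have "0 \<le> F"
  proof cases
    case all
    have h1: "2*X \<le> N" and h2: "2*Y \<le> N" using all a b q1 q2 by auto
    note h3 = q3[OF all]
    \<comment> \<open>bilinear interpolation at \<open>(2a, 2b)\<close> of the four corner conditions\<close>
    have "0 \<le> (2*a)*(2*b)*(N - (2*X+2*Y-1)) + (2*a)*(1-2*b)*(N - 2*X)
        + (1-2*a)*(2*b)*(N-2*Y) + (1-2*a)*(1-2*b)*(N-1)"
      using a b h1 h2 h3 q0 by (intro add_nonneg_nonneg mult_nonneg_nonneg) auto
    also have "\<dots> + 2*(a-1/2)\<^sup>2 + 2*(b-1/2)\<^sup>2 = F"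
      by (simp add: F_def power2_eq_square algebra_simps)
    moreover have "0 \<le> (a-1/2)\<^sup>2" "0 \<le> (b-1/2)\<^sup>2" by auto
    ultimately show ?thesis by linarith
  next
    case three
    have h1: "2*X \<le> N" and h2: "2*Y \<le> N" using three q1 q2 by auto
    show ?thesis
    proof (cases "N \<le> 2")
      case True
      have "a*(2*X) \<le> a*N" "b*(2*Y) \<le> b*N" using h1 h2 a b by (auto intro: mult_left_mono)
      moreover have "N * (2*a+2*b-1) \<le> 2 * (a\<^sup>2+b\<^sup>2)"
      proof (cases "2*a+2*b-1 \<ge> 0")
        case t: True
        have "N * (2*a+2*b-1) \<le> 2 * (2*a+2*b-1)" by (rule mult_right_mono[OF True t])
        also have "\<dots> \<le> 2 * (a\<^sup>2+b\<^sup>2)" using three by simp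
        finally show ?thesis .
      next
        case False
        have "N * (2*a+2*b-1) \<le> 0" using False q0 by (intro mult_nonneg_nonpos) auto
        also have "0 \<le> 2 * (a\<^sup>2+b\<^sup>2)" by simp
        finally show ?thesis .
      qed
      ultimately show ?thesis by (simp add: F_def algebra_simps)
    next
      case False
      \<comment> \<open>The failing corner (1, 1) makes \<open>F\<close> bounded below by an
        expression linear in a and b. Since 4a, 4b \<le> 2, the positive ones among X - 1 and Y - 1
        are absorbed by \<open>h1\<close>, \<open>h2\<close> or the square below.\<close>
      have *: "F \<ge> N - 2 - 4*a*(X-1) - 4*b*(Y-1)"
        using three(1) by (simp add: F_def algebra_simps)
      have k: "4*c*(U-1) \<le> 2 * max 0 (U-1)" if "0 \<le> c" "c \<le> 1/2" for c U :: real
      proof (cases "U \<ge> 1")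
        case True
        then show ?thesis using mult_right_mono[of c "1/2" "U-1"] that by simp
      next
        case False
        then have "c*(U-1) \<le> 0" using that by (intro mult_nonneg_nonpos) auto
        then show ?thesis by simp
      qed
      have "0 \<le> (X-1)\<^sup>2 + (Y-1)\<^sup>2" by simp
      then have "2*X+2*Y-2 \<le> N" by (simp add: N_def power2_eq_square algebra_simps)
      then show ?thesis
        using * k[OF a, of X] k[OF b, of Y] h1 h2 False
        by (cases "X \<le> 1"; cases "Y \<le> 1") simp_all
    qed
  next
    case not1
    then show ?thesis using one_sided[OF b a, of Y X] q2
      by (simp add: F_def N_def algebra_simps)
  next
    case not2
    then show ?thesis using one_sided[OF a b, of X Y] q1
      by (simp add: F_def N_def algebra_simps)
  qed
  then show ?thesis using goal by simp
qed

lemma gauss_ints_iff: "u \<in> gauss_ints \<longleftrightarrow> Re u \<in> \<int> \<and> Im u \<in> \<int>"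
  by (force simp: gauss_ints_def Ints_def complex_eq_iff)

text \<open>The conclusion means |p - 2r|^2 \<ge> 2|r|^2. The signs \<open>e\<close>,
  \<open>f\<close> reflect r into the first quadrant, where \<open>quad_cover\<close>
  applies.\<close>

lemma covering_bound:
  assumes rho: "\<bar>Re r\<bar> \<le> 1/2" "\<bar>Im r\<bar> \<le> 1/2"
    and p: "\<And>g. g \<in> gauss_ints \<Longrightarrow> cmod (r - g) < 1 \<Longrightarrow> 1 \<le> cmod (p - g)"
  shows "(cmod p)\<^sup>2 \<le> 2 * (cmod (p - r))\<^sup>2"
proof -
  define e f :: real where "e = (if Re r < 0 then -1 else 1)" and "f = (if Im r < 0 then -1 else 1)"
  define a b X Y where "a = e * Re r" "b = f * Im r" "X = e * Re p" "Y = f * Im p"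
  note defs = this
  have ez: "e \<in> \<int>" "f \<in> \<int>"
    by (auto simp: e_def f_def)
  have "(e * t - h)\<^sup>2 = (t - e * h)\<^sup>2" "(f * t - h)\<^sup>2 = (t - f * h)\<^sup>2" for t h
    by (auto simp: e_def f_def power2_eq_square algebra_simps)
  note sq = this
  have P: "1 \<le> (X - g)\<^sup>2 + (Y - h)\<^sup>2"
    if "g \<in> \<int>" "h \<in> \<int>" "(a - g)\<^sup>2 + (b - h)\<^sup>2 < 1" for g h
  proof -
    have "(cmod (r - Complex (e*g) (f*h)))\<^sup>2 < 1"
      using that(3) by (simp add: cmod_power2 defs sq)
    then have "cmod (r - Complex (e*g) (f*h)) < 1"
      by (simp add: power_less_one_iff)
    moreover have "Complex (e*g) (f*h) \<in> gauss_ints"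
      using that ez by (simp add: gauss_ints_iff)
    ultimately have "1 \<le> (cmod (p - Complex (e*g) (f*h)))\<^sup>2"
      using p by (simp add: one_le_power)
    then show ?thesis by (simp add: cmod_power2 defs sq)
  qed
  have ab: "0 \<le> a" "a \<le> 1/2" "0 \<le> b" "b \<le> 1/2"
    using rho by (auto simp: defs e_def f_def)
  have "a\<^sup>2 \<le> (1/2)\<^sup>2" "b\<^sup>2 \<le> (1/2)\<^sup>2" using ab by (auto intro: power_mono)
  then have "a\<^sup>2 + b\<^sup>2 < 1" by (simp add: power2_eq_square)
  then have "X\<^sup>2 + Y\<^sup>2 \<le> 2 * ((X - a)\<^sup>2 + (Y - b)\<^sup>2)"
    using P[of 0 0] P[of 1 0] P[of 0 1] P[of 1 1] ab
    by (intro quad_cover) auto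
  moreover have "(X - a)\<^sup>2 = (Re p - Re r)\<^sup>2" "(Y - b)\<^sup>2 = (Im p - Im r)\<^sup>2"
    "X\<^sup>2 = (Re p)\<^sup>2" "Y\<^sup>2 = (Im p)\<^sup>2"
    by (auto simp: defs sq e_def f_def power2_eq_square algebra_simps)
  ultimately show ?thesis by (simp add: cmod_power2)
qed

section \<open>The denominators of the Hurwitz expansion\<close>

text \<open>Expanding the squares gives |u + cv|^2 + |u|^2 = |v + cnj(c) u|^2 + |v|^2. So inverting
  u/v turns |u/v + c| < 1 into |v/u + cnj(c)| < 1.\<close>

lemma cmod_swap:
  assumes "(cmod c)\<^sup>2 = 2" "cmod (u + c * v) < cmod v"
  shows "cmod (v + cnj c * u) < cmod u"
proof -
  have "(cmod (u + c * v))\<^sup>2 + (cmod u)\<^sup>2 * ((cmod c)\<^sup>2 - 1) = (cmod (v + cnj c * u))\<^sup>2 + (cmod v)\<^sup>2 * ((cmod c)\<^sup>2 - 1)"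
    unfolding cmod_power2 by (simp add: power2_eq_square algebra_simps)
  with assms(1) have "(cmod (u + c * v))\<^sup>2 + (cmod u)\<^sup>2 = (cmod (v + cnj c * u))\<^sup>2 + (cmod v)\<^sup>2"
    by simp
  moreover have "(cmod (u + c * v))\<^sup>2 < (cmod v)\<^sup>2"
    using assms(2) by (intro power_strict_mono) auto
  ultimately have "(cmod (v + cnj c * u))\<^sup>2 < (cmod u)\<^sup>2" by linarith
  then show ?thesis by (rule power_less_imp_less_base) simp
qed

text \<open>\<open>cf_den_prev a n\<close> is \<open>Q\<^sub>n\<^sub>-\<^sub>1\<close>, including \<open>Q\<^sub>-\<^sub>1 = 0\<close>.\<close>

definition cf_den_prev :: "(nat \<Rightarrow> 'a::comm_ring_1) \<Rightarrow> nat \<Rightarrow> 'a" where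
  "cf_den_prev a n = (if n = 0 then 0 else cf_den a (n - 1))"

lemma cf_den_Suc: "cf_den a (Suc n) = a (Suc n) * cf_den a n + cf_den_prev a n"
  by (cases n) (auto simp: cf_den_prev_def)

lemma cf_den_prev_Suc [simp]: "cf_den_prev a (Suc n) = cf_den a n"
  by (simp add: cf_den_prev_def)

lemma cf_det: "cf_num a (Suc n) * cf_den a n - cf_num a n * cf_den a (Suc n) = (-1) ^ n"
  by (induction n) (auto simp: algebra_simps)

lemma gauss_ints_closed [simp]:
  "0 \<in> gauss_ints" "1 \<in> gauss_ints" "\<i> \<in> gauss_ints"
  "u \<in> gauss_ints \<Longrightarrow> v \<in> gauss_ints \<Longrightarrow> u + v \<in> gauss_ints"
  "u \<in> gauss_ints \<Longrightarrow> v \<in> gauss_ints \<Longrightarrow> u - v \<in> gauss_ints"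
  "u \<in> gauss_ints \<Longrightarrow> v \<in> gauss_ints \<Longrightarrow> u * v \<in> gauss_ints"
  "u \<in> gauss_ints \<Longrightarrow> - u \<in> gauss_ints"
  "u \<in> gauss_ints \<Longrightarrow> cnj u \<in> gauss_ints"
  "of_int k \<in> gauss_ints"
  by (auto simp: gauss_ints_iff)

lemma cf_gauss_ints:
  assumes "\<And>k. a k \<in> gauss_ints"
  shows "cf_num a n \<in> gauss_ints" "cf_den a n \<in> gauss_ints"
proof -
  have "cf_num a n \<in> gauss_ints \<and> cf_num a (Suc n) \<in> gauss_ints"
    by (induction n) (auto simp: assms)
  moreover have "cf_den a n \<in> gauss_ints \<and> cf_den a (Suc n) \<in> gauss_ints"
    by (induction n) (auto simp: assms assms[of "Suc 0"])
  ultimately show "cf_num a n \<in> gauss_ints" "cf_den a n \<in> gauss_ints" by auto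
qed

section \<open>Gaussian integers near 0 and inversion of the rounding square\<close>

lemma gauss_round_box: "\<bar>Re (u - gauss_round u)\<bar> \<le> 1/2" "\<bar>Im (u - gauss_round u)\<bar> \<le> 1/2"
  using ceiling_half_dist by (simp_all add: gauss_round_def)

text \<open>A sum of two squares below 4 is 0, 1 or 2. The split isolates |c|^2 = 2, the case not
  excluded by \<open>inverse_box_far\<close>.\<close>

lemma gauss_ints_cmod_cases:
  assumes "c \<in> gauss_ints" "cmod c < 2"
  obtains "c = 0" | "c \<in> {1, -1, \<i>, -\<i>}" | "(cmod c)\<^sup>2 = 2"
proof -
  obtain s t :: int where c: "c = Complex (of_int s) (of_int t)"
    using assms(1) by (auto simp: gauss_ints_def)
  have "(cmod c)\<^sup>2 < 2\<^sup>2" using assms(2) by (intro power_strict_mono) auto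
  then have "real_of_int (s\<^sup>2 + t\<^sup>2) < of_int 4" by (simp add: c cmod_power2)
  then have st: "s\<^sup>2 + t\<^sup>2 < 4" by (simp only: of_int_less_iff)
  have bd: "\<bar>k\<bar> \<le> 1" if "k\<^sup>2 < 4" for k :: int
  proof -
    have "\<bar>k\<bar>\<^sup>2 < 2\<^sup>2" using that by simp
    then have "\<bar>k\<bar> < 2" by (rule power_less_imp_less_base) simp
    then show ?thesis by simp
  qed
  have "s\<^sup>2 < 4" "t\<^sup>2 < 4" using st by (smt (verit) zero_le_power2)+
  then have "s \<in> {-1,0,1}" "t \<in> {-1,0,1}" using bd[of s] bd[of t] by auto
  then show ?thesis using that by (auto simp: c cmod_power2 complex_eq_iff)
qed

text \<open>Multiplied by |s|, the claim is |1 - cs| \<ge> |s|. For a unit c this says Re(cs) \<le>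
  1/2, and units preserve the square.\<close>

lemma inverse_box_far:
  assumes s: "s \<noteq> 0" "\<bar>Re s\<bar> \<le> 1/2" "\<bar>Im s\<bar> \<le> 1/2"
    and c: "c \<in> {0, 1, -1, \<i>, -\<i>}"
  shows "1 \<le> cmod (inverse s - c)"
proof -
  have sq: "t\<^sup>2 \<le> 1/4" if "\<bar>t\<bar> \<le> 1/2" for t :: real
    using power_mono[OF that, of 2] by (simp add: power2_eq_square)
  have "(cmod s)\<^sup>2 \<le> (cmod (1 - c * s))\<^sup>2"
    using c s(2,3) sq[OF s(2)] sq[OF s(3)]
    unfolding cmod_power2 by (auto simp: power2_eq_square algebra_simps abs_le_iff)
  then have "cmod s \<le> cmod (1 - c * s)"
    by (rule power2_le_imp_le) simp
  moreover have "cmod (1 - c * s) = cmod (inverse s - c) * cmod s"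
    using s(1) by (simp flip: norm_mult) (simp add: algebra_simps)
  ultimately show ?thesis using s(1) by (simp add: mult_le_cancel_right1)
qed

declare hurwitz_rem.simps(2) [simp del]

section \<open>Growth of the denominators and the approximation error\<close>

context
  fixes z :: complex
begin

private abbreviation (input) "rem \<equiv> hurwitz_rem z"
private abbreviation (input) "a \<equiv> hurwitz_digit z"
private abbreviation (input) "P \<equiv> cf_num (hurwitz_digit z)"
private abbreviation (input) "Q \<equiv> cf_den (hurwitz_digit z)"

lemma hurwitz_digit_gauss: "hurwitz_digit z k \<in> gauss_ints"
  by (simp add: hurwitz_digit_def gauss_round_in)

lemma hurwitz_frac_box:
  "\<bar>Re (hurwitz_rem z k - hurwitz_digit z k)\<bar> \<le> 1/2"
  "\<bar>Im (hurwitz_rem z k - hurwitz_digit z k)\<bar> \<le> 1/2"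
  unfolding hurwitz_digit_def by (rule gauss_round_box)+

lemma hurwitz_frac_less_1: "cmod (hurwitz_rem z k - hurwitz_digit z k) < 1"
proof -
  have "(cmod (rem k - a k))\<^sup>2 < 1"
    using gauss_round_dist[of "rem k"] by (simp add: hurwitz_digit_def)
  then show ?thesis by (simp add: power_less_one_iff)
qed

lemma hurwitz_rem_Suc': "hurwitz_rem z (Suc k) = inverse (hurwitz_rem z k - hurwitz_digit z k)"
  by (simp add: hurwitz_digit_def hurwitz_rem.simps(2))

text \<open>
  In the induction only \<open>|c|\<^sup>2 = 2\<close> matters: then inversion maps the unit disc around \<open>c\<close> to the
  one around \<open>cnj c\<close>, and a counterexample \<open>c\<close> at \<open>n + 1\<close> yields the counterexample \<open>a\<^sub>n\<^sub>+\<^sub>1 + cnj c\<close> at \<open>n\<close>.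
\<close>

lemma hurwitz_den_avoids:
  assumes "\<And>k. k \<le> n \<Longrightarrow> \<not> hurwitz_stops z k"
  shows "cf_den (hurwitz_digit z) n \<noteq> 0 \<and>
    (\<forall>c \<in> gauss_ints. cmod (hurwitz_rem z (Suc n) - c) < 1 \<longrightarrow>
      cmod (cf_den (hurwitz_digit z) n) \<le>
      cmod (cf_den_prev (hurwitz_digit z) n + c * cf_den (hurwitz_digit z) n))"
  using assms
proof (induction n)
  case 0
  have nz: "rem 0 - a 0 \<noteq> 0" using 0[of 0] by (simp add: hurwitz_stops_def)
  have "1 \<le> cmod c" if c: "c \<in> gauss_ints" "cmod (rem (Suc 0) - c) < 1" for c
  proof (rule ccontr)
    assume "\<not> 1 \<le> cmod c"
    then have "cmod c < 2" "(cmod c)\<^sup>2 < 2" "cmod c < 1"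
      using power_less_one_iff[of "cmod c" 2] by auto
    with c(1) have "c = 0" by (auto elim!: gauss_ints_cmod_cases)
    then show False
      using c(2) inverse_box_far[OF nz hurwitz_frac_box, of 0] by (simp add: hurwitz_rem_Suc')
  qed
  then show ?case by (auto simp: cf_den_prev_def)
next
  case (Suc n)
  define s where "s = rem (Suc n) - a (Suc n)"
  have s0: "s \<noteq> 0" using Suc.prems[of "Suc n"] by (simp add: s_def hurwitz_stops_def)
  have box: "\<bar>Re s\<bar> \<le> 1/2" "\<bar>Im s\<bar> \<le> 1/2" unfolding s_def by (rule hurwitz_frac_box)+
  have rs: "rem (Suc (Suc n)) = inverse s" unfolding s_def by (rule hurwitz_rem_Suc')
  have IH: "Q n \<noteq> 0" "\<And>c. c \<in> gauss_ints \<Longrightarrow> cmod (rem (Suc n) - c) < 1 \<Longrightarrow>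
      cmod (Q n) \<le> cmod (cf_den_prev a n + c * Q n)"
    using Suc.IH Suc.prems by auto
  have le: "cmod (Q n) \<le> cmod (Q (Suc n))"
    using IH(2)[OF hurwitz_digit_gauss hurwitz_frac_less_1] by (simp add: cf_den_Suc add.commute)
  have "cmod (Q (Suc n)) \<le> cmod (Q n + c * Q (Suc n))"
    if c: "c \<in> gauss_ints" "cmod (inverse s - c) < 1" for c
  proof (rule ccontr)
    assume "\<not> ?thesis"
    then have lt: "cmod (Q n + c * Q (Suc n)) < cmod (Q (Suc n))" by simp
    \<comment> \<open>Removing the summand \<open>Q n\<close> costs at most
      \<open>cmod (Q (Suc n))\<close>, by \<open>le\<close>.\<close>
    have "cmod (c * Q (Suc n)) < 2 * cmod (Q (Suc n))"
      using lt le norm_triangle_ineq4[of "Q n + c * Q (Suc n)" "Q n"] by simp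
    then have "cmod c < 2" by (simp add: norm_mult mult_less_cancel_right)
    with c(1) show False
    proof (cases rule: gauss_ints_cmod_cases)
      case 3
      have "cmod (1 + c * (-s)) < cmod (-s)"
      proof -
        have "1 - c * s = (inverse s - c) * s" using s0 by (simp add: algebra_simps)
        then show ?thesis using c(2) s0 by (simp add: norm_mult)
      qed
      from cmod_swap[OF 3 this] have "cmod (rem (Suc n) - (a (Suc n) + cnj c)) < 1"
        by (simp add: s_def norm_minus_commute algebra_simps)
      then have "cmod (Q n) \<le> cmod (cf_den_prev a n + (a (Suc n) + cnj c) * Q n)"
        using c(1) by (intro IH(2)) (auto simp: hurwitz_digit_gauss)
      also have "cf_den_prev a n + (a (Suc n) + cnj c) * Q n = Q (Suc n) + cnj c * Q n"
        by (simp add: cf_den_Suc algebra_simps)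
      finally show False using cmod_swap[OF 3 lt] by simp
    qed (use inverse_box_far[OF s0 box, of c] c(2) in auto)
  qed
  moreover have "Q (Suc n) \<noteq> 0" using le IH(1) by auto
  ultimately show ?case unfolding rs by simp
qed

lemma hurwitz_den_mono_step:
  assumes "\<And>k. k \<le> n \<Longrightarrow> \<not> hurwitz_stops z k"
  shows "cmod (cf_den (hurwitz_digit z) n) \<le> cmod (cf_den (hurwitz_digit z) (Suc n))"
  using hurwitz_den_avoids[OF assms] hurwitz_digit_gauss[of "Suc n"] hurwitz_frac_less_1[of "Suc n"]
  by (auto simp: cf_den_Suc add.commute)

text \<open>The errors obey the recursion of P and Q. Each complete quotient inverts the preceding
  fractional part, so inductively it takes an error to minus the preceding error.\<close>

lemma hurwitz_error_Suc:
  assumes "\<And>k. k \<le> n \<Longrightarrow> \<not> hurwitz_stops z k"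
  shows "z * cf_den (hurwitz_digit z) (Suc n) - cf_num (hurwitz_digit z) (Suc n) =
    - (hurwitz_rem z (Suc n) - hurwitz_digit z (Suc n)) *
      (z * cf_den (hurwitz_digit z) n - cf_num (hurwitz_digit z) n)"
  using assms
proof (induction n)
  case 0
  then have "rem 0 - a 0 \<noteq> 0" by (simp add: hurwitz_stops_def)
  then have "rem (Suc 0) * (z - a 0) = 1"
    by (subst hurwitz_rem_Suc') simp
  then show ?case by (simp add: algebra_simps)
next
  case (Suc n)
  have "rem (Suc n) - a (Suc n) \<noteq> 0" using Suc.prems[of "Suc n"] by (simp add: hurwitz_stops_def)
  then have r: "rem (Suc (Suc n)) * (rem (Suc n) - a (Suc n)) = 1"
    by (subst hurwitz_rem_Suc') simp
  define E where "E = z * Q n - P n"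
  define E' where "E' = z * Q (Suc n) - P (Suc n)"
  have E': "E' = - (rem (Suc n) - a (Suc n)) * E"
    using Suc unfolding E_def E'_def by simp
  have "rem (Suc (Suc n)) * E' = - (rem (Suc (Suc n)) * (rem (Suc n) - a (Suc n))) * E"
    by (simp add: E' algebra_simps)
  then have EE: "rem (Suc (Suc n)) * E' = - E" using r by simp
  have "z * Q (Suc (Suc n)) - P (Suc (Suc n)) = a (Suc (Suc n)) * E' + E"
    by (simp add: E_def E'_def algebra_simps)
  also have "\<dots> = - (rem (Suc (Suc n)) - a (Suc (Suc n))) * E'"
    using EE by (simp add: algebra_simps)
  finally show ?case unfolding E'_def .
qed

text \<open>With s the fractional part of z_(n+1), the determinant identity gives |E_n| |Q_(n+1) + s
  Q_n| = 1. The covering bound for p = Q_(n+1)/Q_n and r = -s then compares the second factor with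
  |Q_(n+1)|.\<close>

lemma hurwitz_error_bound:
  assumes "\<And>k. k \<le> n \<Longrightarrow> \<not> hurwitz_stops z k"
  shows "(cmod (z * cf_den (hurwitz_digit z) n - cf_num (hurwitz_digit z) n))\<^sup>2 *
    (cmod (cf_den (hurwitz_digit z) (Suc n)))\<^sup>2 \<le> 2"
proof -
  define E where "E = z * Q n - P n"
  define s where "s = rem (Suc n) - a (Suc n)"
  have Q0: "Q n \<noteq> 0" and avoid: "\<And>c. c \<in> gauss_ints \<Longrightarrow> cmod (rem (Suc n) - c) < 1 \<Longrightarrow>
      cmod (Q n) \<le> cmod (cf_den_prev a n + c * Q n)"
    using hurwitz_den_avoids[OF assms] by auto
  have "E * (Q (Suc n) + s * Q n) = E * Q (Suc n) - (- s * E) * Q n"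
    by (simp add: algebra_simps)
  also have "- s * E = z * Q (Suc n) - P (Suc n)"
    using hurwitz_error_Suc[OF assms] by (simp add: s_def E_def)
  also have "E * Q (Suc n) - (z * Q (Suc n) - P (Suc n)) * Q n = (-1) ^ n"
    by (simp only: E_def flip: cf_det[of a n]) (simp add: algebra_simps)
  finally have 1: "cmod E * cmod (Q (Suc n) + s * Q n) = 1"
    by (metis norm_minus_cancel norm_mult norm_one norm_power power_one)
  have cov: "(cmod (Q (Suc n) / Q n))\<^sup>2 \<le> 2 * (cmod (Q (Suc n) / Q n - (- s)))\<^sup>2"
  proof (rule covering_bound)
    show "\<bar>Re (- s)\<bar> \<le> 1/2" "\<bar>Im (- s)\<bar> \<le> 1/2"
      using hurwitz_frac_box[of "Suc n"] unfolding s_def by (simp_all add: abs_minus_commute)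
    fix g assume g: "g \<in> gauss_ints" "cmod (- s - g) < 1"
    \<comment> \<open>Since Q_(n+1)/Q_n = a_(n+1) + Q_(n-1)/Q_n, a lattice point g near -s
      corresponds to c = a_(n+1) - g in the invariant.\<close>
    have "- s - g = - (rem (Suc n) - (a (Suc n) - g))" by (simp add: s_def)
    then have "cmod (rem (Suc n) - (a (Suc n) - g)) < 1"
      using g(2) by (metis norm_minus_cancel)
    then have "cmod (Q n) \<le> cmod (cf_den_prev a n + (a (Suc n) - g) * Q n)"
      using g(1) by (intro avoid) (auto simp: hurwitz_digit_gauss)
    also have "cf_den_prev a n + (a (Suc n) - g) * Q n = (Q (Suc n) / Q n - g) * Q n"
      using Q0 by (simp only: left_diff_distrib) (simp add: cf_den_Suc left_diff_distrib)
    finally show "1 \<le> cmod (Q (Suc n) / Q n - g)"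
      using Q0 by (simp add: norm_mult)
  qed
  have "(cmod (Q (Suc n)))\<^sup>2 = (cmod (Q (Suc n) / Q n))\<^sup>2 * (cmod (Q n))\<^sup>2"
    using Q0 by (simp add: norm_divide power_divide)
  also have "\<dots> \<le> 2 * (cmod (Q (Suc n) / Q n - (- s)))\<^sup>2 * (cmod (Q n))\<^sup>2"
    by (intro mult_right_mono cov) simp
  also have "\<dots> = 2 * (cmod ((Q (Suc n) / Q n - (- s)) * Q n))\<^sup>2"
    by (simp only: norm_mult power_mult_distrib mult.assoc)
  also have "(Q (Suc n) / Q n - (- s)) * Q n = Q (Suc n) + s * Q n"
    using Q0 by (simp add: distrib_right)
  finally have "(cmod (Q (Suc n)))\<^sup>2 \<le> 2 * (cmod (Q (Suc n) + s * Q n))\<^sup>2" .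
  then have "(cmod E)\<^sup>2 * (cmod (Q (Suc n)))\<^sup>2 \<le> (cmod E)\<^sup>2 * (2 * (cmod (Q (Suc n) + s * Q n))\<^sup>2)"
    by (intro mult_left_mono) auto
  also have "\<dots> = 2 * (cmod E * cmod (Q (Suc n) + s * Q n))\<^sup>2"
    by (simp add: power_mult_distrib)
  finally show ?thesis using 1 by (simp add: E_def)
qed

end

lemma hurwitz_den_mono:
  assumes "i \<le> j" "\<And>k. k < j \<Longrightarrow> \<not> hurwitz_stops z k"
  shows "cmod (cf_den (hurwitz_digit z) i) \<le> cmod (cf_den (hurwitz_digit z) j)"
  using assms
proof (induction j rule: dec_induct)
  case (step n)
  then have "cmod (cf_den (hurwitz_digit z) i) \<le> cmod (cf_den (hurwitz_digit z) n)" by simp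
  also have "\<dots> \<le> cmod (cf_den (hurwitz_digit z) (Suc n))"
    using step.prems by (intro hurwitz_den_mono_step) auto
  finally show ?case .
qed simp

lemma hurwitz_error_last:
  assumes "hurwitz_stops z m" "\<And>k. k < m \<Longrightarrow> \<not> hurwitz_stops z k"
  shows "z * cf_den (hurwitz_digit z) m = cf_num (hurwitz_digit z) m"
proof (cases m)
  case 0
  then show ?thesis using assms(1) by (simp add: hurwitz_stops_def)
next
  case (Suc n)
  have "z * cf_den (hurwitz_digit z) (Suc n) - cf_num (hurwitz_digit z) (Suc n) = 0"
    by (subst hurwitz_error_Suc) (use assms Suc in \<open>auto simp: hurwitz_stops_def\<close>)
  then show ?thesis by (simp add: Suc)
qed

section \<open>Sums of four squares\<close>

lemma gauss_ints_cases:
  assumes "u \<in> gauss_ints"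
  obtains s t :: int where "u = Complex (of_int s) (of_int t)"
  using assms by (auto simp: gauss_ints_def)

lemma gauss_ints_half:
  assumes "u \<in> gauss_ints" "v \<in> gauss_ints" "odd w" "of_int w * u = 2 * v"
  shows "u / 2 \<in> gauss_ints"
proof -
  obtain s t where u: "u = Complex (of_int s) (of_int t)" using assms(1) by (rule gauss_ints_cases)
  obtain s' t' where v: "v = Complex (of_int s') (of_int t')" using assms(2) by (rule gauss_ints_cases)
  have "real_of_int (w * s) = of_int (2 * s')" "real_of_int (w * t) = of_int (2 * t')"
    using assms(4) by (auto simp: u v complex_eq_iff)
  then have "w * s = 2 * s'" "w * t = 2 * t'" by (simp_all only: of_int_eq_iff)
  then have "even (w * s)" "even (w * t)" by auto
  with assms(3) have "even s" "even t" by auto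
  then show ?thesis by (auto simp: u gauss_ints_iff elim!: evenE)
qed

text \<open>If 1 + i divided R and Q, it would divide the odd determinant w; so each has exactly one
  odd coordinate. Take u = 1 if these are in the same position, u = i otherwise.\<close>

lemma gauss_halves:
  assumes R: "R \<in> gauss_ints" and Q: "Q \<in> gauss_ints"
    and R': "R' \<in> gauss_ints" and Q': "Q' \<in> gauss_ints"
    and w: "odd w" and det: "R * Q' - R' * Q = of_int w"
    and sum: "(cmod R)\<^sup>2 + (cmod Q)\<^sup>2 = 2 * of_int w"
  obtains u where "u \<in> {1, \<i>}" "(R + u * cnj Q) / 2 \<in> gauss_ints" "(Q - u * cnj R) / 2 \<in> gauss_ints"
proof -
  obtain r s where r: "R = Complex (of_int r) (of_int s)" using R by (rule gauss_ints_cases)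
  obtain p q where p: "Q = Complex (of_int p) (of_int q)" using Q by (rule gauss_ints_cases)
  obtain r' s' where r': "R' = Complex (of_int r') (of_int s')" using R' by (rule gauss_ints_cases)
  obtain p' q' where p': "Q' = Complex (of_int p') (of_int q')" using Q' by (rule gauss_ints_cases)
  have "real_of_int (r * p' - s * q' - (r' * p - s' * q)) = of_int w"
    "real_of_int (r * q' + s * p' - (r' * q + s' * p)) = of_int 0"
    using det by (auto simp: r p r' p' complex_eq_iff)
  then have d: "r * p' - s * q' - (r' * p - s' * q) = w" "r * q' + s * p' - (r' * q + s' * p) = 0"
    by (simp_all only: of_int_eq_iff)
  have "real_of_int (r\<^sup>2 + s\<^sup>2 + (p\<^sup>2 + q\<^sup>2)) = of_int (2 * w)"
    using sum by (simp add: r p cmod_power2)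
  then have "r\<^sup>2 + s\<^sup>2 + (p\<^sup>2 + q\<^sup>2) = 2 * w" by (simp only: of_int_eq_iff)
  then have "even (r\<^sup>2 + s\<^sup>2 + (p\<^sup>2 + q\<^sup>2))" by simp
  then have 1: "even (r + s) \<longleftrightarrow> even (p + q)" by auto
  have "odd (r * p' - s * q' - (r' * p - s' * q))" "even (r * q' + s * p' - (r' * q + s' * p))"
    using d w by simp_all
  with 1 have 2: "odd (r + s)" "odd (p + q)" by auto
  have half: "Complex (of_int k) (of_int l) / 2 \<in> gauss_ints" if "even k" "even l" for k l
    using that by (auto simp: gauss_ints_iff elim!: evenE)
  show ?thesis
  proof (cases "even (r + p)")
    case True
    have "R + 1 * cnj Q = Complex (of_int (r + p)) (of_int (s - q))"
      "Q - 1 * cnj R = Complex (of_int (p - r)) (of_int (q + s))"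
      by (auto simp: r p complex_eq_iff)
    moreover have "even (s - q)" "even (p - r)" "even (q + s)" using True 2 by auto
    ultimately show ?thesis using that[of 1] half True by (metis insertI1)
  next
    case False
    have "R + \<i> * cnj Q = Complex (of_int (r + q)) (of_int (s + p))"
      "Q - \<i> * cnj R = Complex (of_int (p - s)) (of_int (q - r))"
      by (auto simp: r p complex_eq_iff)
    moreover have "even (r + q)" "even (s + p)" "even (p - s)" "even (q - r)" using False 2 by auto
    ultimately show ?thesis using that[of \<i>] half by (metis insertI1 insertI2)
  qed
qed

text \<open>As D is a unit, (R, Q) and (R', Q') form a basis of the lattice of vectors (\<alpha>q -
  wp, q). Expressing the half vector (R1, Q1) in it gives a unit coefficient at (R', Q') and 0 or 1
  at (R, Q).\<close>

lemma norm_two_next_small: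
  fixes w M :: int
  assumes gi: "\<alpha> \<in> gauss_ints" "P \<in> gauss_ints" "Q \<in> gauss_ints" "P' \<in> gauss_ints" "Q' \<in> gauss_ints"
    and w: "odd w" "0 < w" and M: "\<alpha> * cnj \<alpha> + 1 = of_int w * of_int M"
    and D: "P' * Q - P * Q' = D" "D \<in> {1, -1}"
    and R: "R = \<alpha> * Q - of_int w * P" and R': "R' = \<alpha> * Q' - of_int w * P'"
    and rho: "R' = \<rho> * R" "\<bar>Re \<rho>\<bar> \<le> 1/2" "\<bar>Im \<rho>\<bar> \<le> 1/2"
    and sum: "(cmod R)\<^sup>2 + (cmod Q)\<^sup>2 = 2 * of_int w" and Qw: "(cmod Q)\<^sup>2 < of_int w"
  shows "(cmod Q')\<^sup>2 \<le> of_int w"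
proof -
  have Rgi: "R \<in> gauss_ints" "R' \<in> gauss_ints" using gi by (auto simp: R R')
  have w0: "complex_of_int w \<noteq> 0" using w by simp
  have DD: "D * D = 1" using D by auto
  have "R * Q' - R' * Q = of_int w * D"
    unfolding R R' D(1)[symmetric] by (simp add: algebra_simps)
  then have "R * (D * Q') - (D * R') * Q = of_int w * (D * D)"
    by (simp add: algebra_simps)
  then have "R * (D * Q') - (D * R') * Q = of_int w" by (simp add: DD)
  moreover have "D \<in> gauss_ints" using D by auto
  ultimately obtain u where u: "u \<in> {1, \<i>}"
    and half: "(R + u * cnj Q) / 2 \<in> gauss_ints" "(Q - u * cnj R) / 2 \<in> gauss_ints"
    using gauss_halves[of R Q "D * R'" "D * Q'" w] Rgi gi w sum by auto
  define R1 Q1 where "R1 = (R + u * cnj Q) / 2" and "Q1 = (Q - u * cnj R) / 2"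
  \<comment> \<open>Half of \<open>T\<close> is the numerator belonging to (R1, Q1). Divisibility of
    \<alpha> Q1 - R1 by w comes from |\<alpha>|^2 + 1 = wM, and halving is possible because w is
    odd.\<close>
  define T where "T = P - u * (of_int M * cnj Q - \<alpha> * cnj P)"
  have two: "2 * R1 = R + u * cnj Q" "2 * Q1 = Q - u * cnj R"
    by (simp_all add: R1_def Q1_def)
  have "2 * (\<alpha> * Q1 - R1) = \<alpha> * (2 * Q1) - 2 * R1" by (simp add: algebra_simps)
  also have "\<dots> = \<alpha> * Q - R - u * (\<alpha> * cnj R + cnj Q)"
    unfolding two by (simp add: algebra_simps)
  also have "\<alpha> * cnj R + cnj Q = (\<alpha> * cnj \<alpha> + 1) * cnj Q - of_int w * (\<alpha> * cnj P)"
    by (simp add: R algebra_simps)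
  also have "\<alpha> * Q - R - u * \<dots> = of_int w * T"
    unfolding M by (simp add: R T_def algebra_simps)
  finally have T: "of_int w * T = 2 * (\<alpha> * Q1 - R1)" by simp
  define P1 where "P1 = T / 2"
  have "u \<in> gauss_ints" using u by auto
  then have "T \<in> gauss_ints" unfolding T_def using gi by auto
  moreover have gi1: "R1 \<in> gauss_ints" "Q1 \<in> gauss_ints" using half by (auto simp: R1_def Q1_def)
  ultimately have P1gi: "P1 \<in> gauss_ints"
    unfolding P1_def using gi w by (intro gauss_ints_half[OF _ _ w(1) T]) auto
  have R1: "R1 = \<alpha> * Q1 - of_int w * P1"
  proof -
    have "2 * R1 = 2 * (\<alpha> * Q1 - of_int w * P1)"
      using T by (simp add: P1_def algebra_simps)
    then show ?thesis unfolding mult_cancel_left by simp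
  qed
  \<comment> \<open>Coordinates by Cramer's rule.\<close>
  define x y where "x = - D * (P1 * Q' - P' * Q1)" and "y = D * (P1 * Q - P * Q1)"
  have comb: "D * D * P1 = x * P + y * P'" "D * D * Q1 = x * Q + y * Q'"
    by (simp_all add: x_def y_def flip: D(1)) (simp_all add: algebra_simps)
  then have comb: "P1 = x * P + y * P'" "Q1 = x * Q + y * Q'" using DD by simp_all
  have comb': "R1 = x * R + y * R'" by (simp add: R1 R R' comb algebra_simps)
  \<comment> \<open>The determinant of (R1, Q1) and (R, Q) is uw, which makes \<open>y\<close> a
    unit.\<close>
  have "of_int w * (P1 * Q - P * Q1) = - (R1 * Q - R * Q1)"
    by (simp add: R1 R algebra_simps)
  also have "R1 * Q - R * Q1 = u * ((R * cnj R + Q * cnj Q) / 2)"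
    by (simp add: R1_def Q1_def field_simps)
  also have "R * cnj R + Q * cnj Q = of_real ((cmod R)\<^sup>2 + (cmod Q)\<^sup>2)"
    by (simp only: of_real_add complex_norm_square)
  also have "\<dots> = 2 * of_int w" unfolding sum by simp
  finally have "of_int w * (P1 * Q - P * Q1) = of_int w * (- u)" by simp
  then have "P1 * Q - P * Q1 = - u" using w0 unfolding mult_cancel_left by simp
  then have "y = - D * u" by (simp add: y_def)
  then have y: "y \<in> {1, -1, \<i>, -\<i>}" using D u by auto
  have RQ: "cmod Q < cmod R"
  proof (rule power_less_imp_less_base)
    show "(cmod Q)\<^sup>2 < (cmod R)\<^sup>2" using sum Qw by linarith
  qed simp
  then have R0: "R \<noteq> 0" by auto
  \<comment> \<open>|Q| < |R| confines \<theta> = x + y\<rho> to 0 < Re \<theta> < 1, |Im \<theta>|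
    < 1/2. As y\<rho> stays in the square of side 1, only x = 0 and x = 1 remain.\<close>
  define \<theta> where "\<theta> = R1 / R"
  have "2 * \<theta> - 1 = u * cnj Q / R" using R0 by (simp add: \<theta>_def R1_def field_simps)
  then have "cmod (2 * \<theta> - 1) < 1" using RQ R0 u by (auto simp: norm_divide norm_mult)
  then have th: "\<bar>2 * Re \<theta> - 1\<bar> < 1" "\<bar>2 * Im \<theta>\<bar> < 1"
    using abs_Re_le_cmod[of "2 * \<theta> - 1"] abs_Im_le_cmod[of "2 * \<theta> - 1"] by auto
  have "\<theta> = x + y * \<rho>" using R0 by (simp add: \<theta>_def comb' rho(1) field_simps)
  then have "Re \<theta> = Re x + Re (y * \<rho>)" "Im \<theta> = Im x + Im (y * \<rho>)" by (simp_all only: plus_complex.sel)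
  moreover have "\<bar>Re (y * \<rho>)\<bar> \<le> 1/2" "\<bar>Im (y * \<rho>)\<bar> \<le> 1/2" using y rho(2,3) by auto
  ultimately have xb: "\<bar>Re x - 1/2\<bar> < 1" "\<bar>Im x\<bar> < 1" using th by linarith+
  have "x \<in> gauss_ints" using gi P1gi gi1 \<open>D \<in> gauss_ints\<close> by (auto simp: x_def)
  then obtain s t where st: "x = Complex (of_int s) (of_int t)" by (rule gauss_ints_cases)
  have "t = 0" "s = 0 \<or> s = 1" using xb unfolding st by auto
  then have "x = 0 \<or> x = 1" by (auto simp: st complex_eq_iff)
  \<comment> \<open>Second coordinate of the other half vector; the parallelogram law gives |Q1|^2 +
    |Q2|^2 = w.\<close>
  define Q2 where "Q2 = (Q + u * cnj R) / 2"
  have "Q1 - Q = - Q2" by (simp add: Q1_def Q2_def field_simps)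
  moreover have "y * Q' = Q1 \<or> y * Q' = Q1 - Q"
    using \<open>x = 0 \<or> x = 1\<close> comb(2) by auto
  moreover have "cmod (y * Q') = cmod Q'" using y by (auto simp: norm_mult)
  ultimately have "cmod Q' = cmod Q1 \<or> cmod Q' = cmod Q2"
    by (metis norm_minus_cancel)
  then have "(cmod Q')\<^sup>2 \<le> (cmod Q1)\<^sup>2 + (cmod Q2)\<^sup>2" by auto
  also have "\<dots> = ((cmod R)\<^sup>2 + (cmod Q)\<^sup>2) / 2"
    using u unfolding Q1_def Q2_def cmod_power2 by (auto simp: power2_eq_square field_simps)
  finally show ?thesis using sum by simp
qed

section \<open>The index n and the representation of w\<close>

theorem theorem1:
  fixes w x y :: int and z :: complex and m :: nat and a P Q :: "nat \<Rightarrow> complex"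
  assumes "w > 0" and "odd w" and "\<not> is_square w"
    and "0 \<le> x" and "real_of_int x < real_of_int w / 2"
    and "0 \<le> y" and "real_of_int y < real_of_int w / 2"
    and "[x\<^sup>2 + y\<^sup>2 = -1] (mod w)"
    and "z = (of_int x + of_int y * \<i>) / of_int w"
    and "a = hurwitz_digit z" and "m = hurwitz_last z"
    and "P = cf_num a" and "Q = cf_den a"
  shows "hurwitz_stops z m \<and> a 0 = 0 \<and>
    (\<exists>!n. n < m \<and> cmod (Q n) \<le> sqrt (real_of_int w) \<and> sqrt (real_of_int w) < cmod (Q (n + 1))) \<and>
    (\<forall>n. n < m \<and> cmod (Q n) \<le> sqrt (real_of_int w) \<and> sqrt (real_of_int w) < cmod (Q (n + 1)) \<and>
         cmod (Q n) \<noteq> sqrt (real_of_int w) \<longrightarrow>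
       real_of_int w =
         (cmod ((of_int x + of_int y * \<i>) * Q n - of_int w * P n))\<^sup>2 + (cmod (Q n))\<^sup>2 \<and>
       (\<exists>A B C D :: int.
          (of_int x + of_int y * \<i>) * Q n - of_int w * P n = Complex (of_int A) (of_int B) \<and>
          Q n = Complex (of_int C) (of_int D) \<and>
          w = A\<^sup>2 + B\<^sup>2 + C\<^sup>2 + D\<^sup>2))"
proof -
  define \<alpha> :: complex where "\<alpha> = of_int x + of_int y * \<i>"
  have \<alpha>gi: "\<alpha> \<in> gauss_ints" by (simp add: \<alpha>_def)
  have w0: "complex_of_int w \<noteq> 0" using \<open>w > 0\<close> by simp
  have z: "of_int w * z = \<alpha>" using w0 assms(9) by (simp add: \<alpha>_def)
  have zq: "z = \<alpha> / of_int w" using assms(9) by (simp add: \<alpha>_def)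
  have w1: "1 < w" using \<open>w > 0\<close> \<open>\<not> is_square w\<close> by (cases "w = 1") auto
  from \<open>[x\<^sup>2 + y\<^sup>2 = -1] (mod w)\<close> obtain M where M: "x\<^sup>2 + y\<^sup>2 + 1 = w * M"
    by (auto simp: cong_iff_dvd_diff elim!: dvdE)
  have "of_int (x\<^sup>2 + y\<^sup>2 + 1) = complex_of_int (w * M)" unfolding M ..
  then have M\<alpha>: "\<alpha> * cnj \<alpha> + 1 = of_int w * of_int M"
    by (simp add: \<alpha>_def complex_eq_iff power2_eq_square)
  have PQ: "P n \<in> gauss_ints" "Q n \<in> gauss_ints" for n
    unfolding assms by (rule cf_gauss_ints, rule hurwitz_digit_gauss)+
  have stops: "hurwitz_stops z m"
    using hurwitz_terminates[of \<alpha> "of_int w"] w0 \<alpha>gi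
    by (auto simp: assms(11) hurwitz_last_def zq intro: LeastI_ex)
  have nostop: "\<not> hurwitz_stops z k" if "k < m" for k
    using that not_less_Least unfolding assms(11) hurwitz_last_def by blast
  have mono: "cmod (Q i) \<le> cmod (Q j)" if "i \<le> j" "j \<le> m" for i j
    unfolding assms using that nostop by (intro hurwitz_den_mono) (auto simp: assms)
  have Q0: "Q 0 = 1" by (simp add: assms)
  have Q1: "1 \<le> cmod (Q n)" if "n \<le> m" for n using mono[of 0 n] that by (simp add: Q0)
  have a0: "a 0 = 0"
  proof -
    have "\<lceil>real_of_int k / of_int w - 1/2\<rceil> = 0" if "0 \<le> k" "real_of_int k < of_int w / 2" for k
    proof -
      have "real_of_int k / of_int w < 1/2" "0 \<le> real_of_int k / of_int w"
        using that \<open>w > 0\<close> by (auto simp: field_simps)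
      then show ?thesis by linarith
    qed
    moreover have "Re z = of_int x / of_int w" "Im z = of_int y / of_int w"
      by (simp_all add: zq \<alpha>_def)
    ultimately show ?thesis
      using assms by (simp add: hurwitz_digit_def gauss_round_def complex_eq_iff)
  qed
  have Qm: "sqrt w < cmod (Q m)"
  proof -
    have "z * Q m = P m" unfolding assms(10,12,13)
      using stops nostop by (rule hurwitz_error_last)
    then have "\<alpha> * Q m = of_int w * P m" by (simp flip: z)
    \<comment> \<open>Multiplying by the conjugate of \<alpha>, where |\<alpha>|^2 is -1 modulo w,
      shows that w divides Q_m; hence |Q_m| \<ge> w.\<close>
    then have "(\<alpha> * cnj \<alpha> + 1) * Q m = Q m + of_int w * (cnj \<alpha> * P m)"
      by (simp add: algebra_simps)
    then have "Q m = of_int w * (of_int M * Q m - cnj \<alpha> * P m)"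
      unfolding M\<alpha> by (simp add: algebra_simps)
    then have "cmod (Q m) = cmod (of_int w * (of_int M * Q m - cnj \<alpha> * P m))" by (rule arg_cong)
    then have eq: "cmod (Q m) = w * cmod (of_int M * Q m - cnj \<alpha> * P m)"
      using \<open>w > 0\<close> by (simp add: norm_mult)
    define g where "g = of_int M * Q m - cnj \<alpha> * P m"
    have "g \<in> gauss_ints" using \<alpha>gi PQ by (simp add: g_def)
    then obtain k :: nat where k: "(cmod g)\<^sup>2 = k" using gauss_ints_norm_square by blast
    have "g \<noteq> 0" using eq Q1[of m] by (auto simp: g_def)
    then have "k \<noteq> 0" using k by (intro notI) simp
    then have "1 \<le> (cmod g)\<^sup>2" using k by simp
    then have "1 \<le> cmod g" by (intro power2_le_imp_le[of 1]) simp_all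
    then have "w \<le> cmod (Q m)" using eq \<open>w > 0\<close> by (simp add: g_def)
    moreover have "sqrt w < w" using w1 by (simp add: real_less_lsqrt power2_eq_square)
    ultimately show ?thesis by simp
  qed
  have ex: "\<exists>!n. n < m \<and> cmod (Q n) \<le> sqrt w \<and> sqrt w < cmod (Q (n + 1))"
  proof -
    define N where "N = (LEAST n. sqrt w < cmod (Q n))"
    have N: "sqrt w < cmod (Q N)" unfolding N_def using Qm by (rule LeastI)
    have Nm: "N \<le> m" unfolding N_def using Qm by (rule Least_le)
    have below: "cmod (Q k) \<le> sqrt w" if "k < N" for k
      using not_less_Least[of k "\<lambda>n. sqrt w < cmod (Q n)"] that by (auto simp: N_def)
    have "N \<noteq> 0" using N w1 by (auto simp: Q0 intro!: Nat.gr0I)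
    then obtain n where n: "N = Suc n" by (cases N) auto
    show ?thesis
    proof (rule ex1I[of _ n])
      show "n < m \<and> cmod (Q n) \<le> sqrt w \<and> sqrt w < cmod (Q (n + 1))"
        using n N Nm below[of n] by auto
      fix k assume k: "k < m \<and> cmod (Q k) \<le> sqrt w \<and> sqrt w < cmod (Q (k + 1))"
      have "\<not> n < k" using mono[of "Suc n" k] k N n by auto
      moreover have "\<not> k < n" using below[of "Suc k"] k n by auto
      ultimately show "k = n" by simp
    qed
  qed
  have rep: "real_of_int w = (cmod (\<alpha> * Q n - of_int w * P n))\<^sup>2 + (cmod (Q n))\<^sup>2 \<and>
      (\<exists>A B C D :: int. \<alpha> * Q n - of_int w * P n = Complex (of_int A) (of_int B) \<and>
          Q n = Complex (of_int C) (of_int D) \<and> w = A\<^sup>2 + B\<^sup>2 + C\<^sup>2 + D\<^sup>2)"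
    if n: "n < m" "cmod (Q n) \<le> sqrt w" "sqrt w < cmod (Q (n + 1))" "cmod (Q n) \<noteq> sqrt w" for n
  proof -
    define E where "E k = z * Q k - P k" for k
    define R where "R k = \<alpha> * Q k - of_int w * P k" for k
    have RE: "R k = of_int w * E k" for k by (simp add: R_def E_def algebra_simps flip: z)
    have ns: "\<not> hurwitz_stops z k" if "k \<le> n" for k using that n(1) nostop by auto
    define \<rho> where "\<rho> = - (hurwitz_rem z (Suc n) - hurwitz_digit z (Suc n))"
    have rho: "\<bar>Re \<rho>\<bar> \<le> 1/2" "\<bar>Im \<rho>\<bar> \<le> 1/2"
      using hurwitz_frac_box[of z "Suc n"] unfolding \<rho>_def by (simp_all add: abs_minus_commute)
    have "E (Suc n) = \<rho> * E n"
      unfolding E_def \<rho>_def assms(10,12,13) using ns by (rule hurwitz_error_Suc)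
    then have Rrho: "R (Suc n) = \<rho> * R n" by (simp add: RE)
    have det: "P (Suc n) * Q n - P n * Q (Suc n) = (-1) ^ n"
      unfolding assms by (rule cf_det)
    have Qn: "(cmod (Q n))\<^sup>2 < w" "w < (cmod (Q (Suc n)))\<^sup>2"
    proof -
      \<comment> \<open>The hypothesis |Q_n| \<noteq> sqrt w enters here; this strict bound yields
        \<open>K < 3\<close> below.\<close>
      have "(cmod (Q n))\<^sup>2 < (sqrt w)\<^sup>2" using n by (intro power_strict_mono) auto
      then show "(cmod (Q n))\<^sup>2 < w" using w1 by simp
      have "(sqrt w)\<^sup>2 < (cmod (Q (Suc n)))\<^sup>2" using n w1 by (intro power_strict_mono) auto
      then show "w < (cmod (Q (Suc n)))\<^sup>2" using w1 by simp
    qed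
    have "(cmod (E n))\<^sup>2 * w \<le> (cmod (E n))\<^sup>2 * (cmod (Q (Suc n)))\<^sup>2"
      using Qn by (intro mult_left_mono) auto
    also have "\<dots> \<le> 2"
      unfolding E_def assms(10,12,13) using ns by (rule hurwitz_error_bound)
    finally have "w * ((cmod (E n))\<^sup>2 * w) \<le> real_of_int w * 2"
      using w1 by (intro mult_left_mono) auto
    then have Rn: "(cmod (R n))\<^sup>2 \<le> 2 * w"
      by (simp add: RE norm_mult power_mult_distrib power2_eq_square mult_ac)
    obtain c d where c: "Q n = Complex (of_int c) (of_int d)" using PQ(2) by (rule gauss_ints_cases)
    obtain p q where p: "P n = Complex (of_int p) (of_int q)" using PQ(1) by (rule gauss_ints_cases)
    define A B where "A = x * c - y * d - w * p" and "B = x * d + y * c - w * q"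
    have RAB: "R n = Complex (of_int A) (of_int B)"
      by (simp add: R_def \<alpha>_def c p A_def B_def complex_eq_iff)
    \<comment> \<open>The expansion of |\<alpha>Q - wP|^2 + |Q|^2, with |\<alpha>|^2 + 1 = wM,
      divided by w.\<close>
    define K where "K = M * (c\<^sup>2 + d\<^sup>2) - 2 * ((x * c - y * d) * p + (x * d + y * c) * q) + w * (p\<^sup>2 + q\<^sup>2)"
    have "A\<^sup>2 + B\<^sup>2 + c\<^sup>2 + d\<^sup>2 = (x\<^sup>2 + y\<^sup>2 + 1) * (c\<^sup>2 + d\<^sup>2)
        - 2 * w * ((x * c - y * d) * p + (x * d + y * c) * q) + w * w * (p\<^sup>2 + q\<^sup>2)"
      by (simp add: A_def B_def power2_eq_square algebra_simps)
    also have "\<dots> = w * K" unfolding M by (simp add: K_def algebra_simps)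
    finally have K: "A\<^sup>2 + B\<^sup>2 + c\<^sup>2 + d\<^sup>2 = w * K" .
    have "(cmod (R n))\<^sup>2 + (cmod (Q n))\<^sup>2 = real_of_int (A\<^sup>2 + B\<^sup>2 + c\<^sup>2 + d\<^sup>2)"
      by (simp add: RAB c cmod_power2)
    then have nK: "(cmod (R n))\<^sup>2 + (cmod (Q n))\<^sup>2 = real_of_int (w * K)" unfolding K .
    have "0 < (cmod (Q n))\<^sup>2" using Q1[of n] n(1) by auto
    then have "0 < real_of_int (w * K)" using nK by (smt (verit) zero_le_power2)
    then have "0 < K" using w1 by (simp add: zero_less_mult_iff)
    moreover have "real_of_int (w * K) < of_int (w * 3)" using nK Rn Qn by simp
    then have "K < 3" using w1 by (simp only: of_int_less_iff) simp
    moreover have "K \<noteq> 2"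
    proof
      assume "K = 2"
      then have s: "(cmod (R n))\<^sup>2 + (cmod (Q n))\<^sup>2 = 2 * real_of_int w" using nK by simp
      have "(cmod (Q (Suc n)))\<^sup>2 \<le> w"
        using norm_two_next_small[OF \<alpha>gi PQ(1) PQ(2) PQ(1) PQ(2) \<open>odd w\<close> \<open>w > 0\<close> M\<alpha> det _ R_def R_def Rrho rho s Qn(1)]
        by (cases "even n") auto
      then show False using Qn(2) by simp
    qed
    ultimately have "K = 1" by linarith
    then show ?thesis using nK K RAB c unfolding R_def by auto
  qed
  show ?thesis using stops a0 ex rep unfolding \<alpha>_def by blast
qed

end
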